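(* Consider the following algorithm. Input: an interpreted word-hyperbolic structure $\Sigma$ for a semigroup; write $A=A(\Sigma)$, $L=L(\Sigma)$, $M=M(\Sigma)$. Method: (1) For each $a\in A$, construct the context-free language $I_a=\{i\in L : a\#_1 i\#_2 a\in M\}$ and check that it is non-empty. If any of these checks fail, halt and output No. (2) For each $a\in A$, choose some $i_a\in I_a$. (3) Iterate the following step for each $a\in A$: if $\overline{i_a}\,\overline{b}=\overline{b}\,\overline{i_a}=\overline{b}$ for each $b\in A$, halt and output Yes and $i_a$. (4) Halt and output No. This algorithm outputs Yes and $i$ if and only if the semigroup defined by $\Sigma$ is a monoid with identity $\overline{i}$.
   Context: Maps are written on the right. For a word $u=a_1\cdots a_n$, $u^{\mathrm{rev}}=a_n\cdots a_1$, and $L^{\mathrm{rev}}=\{w^{\mathrm{rev}} : w\in L\}$. $A^+$ is the set of non-empty words over $A$. A semigroup is a monoid if it contains a two-sided identity. A pre-word-hyperbolic structure $\Sigma$ consists of: a finite alphabet $A(\Sigma)$; a regular language $L(\Sigma)$ over $A(\Sigma)$ not containing the empty word; and a context-free language $M(\Sigma)$ over $A(\Sigma)\cup\{\#_1,\#_2\}$, where $\#_1,\#_2$ are new symbols not in $A(\Sigma)$, such that $M(\Sigma)\subseteq L(\Sigma)\#_1L(\Sigma)\#_2L(\Sigma)^{\mathrm{rev}}$. An interpretation of $\Sigma$ with respect to a semigroup $S$ is a homomorphism $\phi:A(\Sigma)^+\to S$ such that $\phi|_{A(\Sigma)}$ is injective, $(L(\Sigma))\phi=S$, and $M(\Sigma)=\{u\#_1v\#_2w^{\mathrm{rev}}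 : u,v,w\in L(\Sigma),\ (u\phi)(v\phi)=w\phi\}$. If $\Sigma$ admits an interpretation with respect to $S$, then $\Sigma$ is a word-hyperbolic structure for $S$; the semigroup $S$ defined by $\Sigma$ is then unique up to isomorphism. An assignment of generators for $\Sigma$ is a map $\alpha:A(\Sigma)\to L(\Sigma)$ such that there is some interpretation $\phi$ with $a\alpha\phi=a\phi$ for all $a\in A(\Sigma)$ (such $\phi$ is said to be consistent with $\alpha$). An interpreted word-hyperbolic structure is a word-hyperbolic structure equipped with an assignment of generators; it is assumed throughout that $A(\Sigma)\subseteq L(\Sigma)$ and that the assignment of generators is the embedding map from $A(\Sigma)$ to $L(\Sigma)$. For $u\in A(\Sigma)^+$, $\overline{u}$ denotes $u\phi$, where $\phi$ is a consistent interpretation. *)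

theory Defs
  imports Main
begin

definition regular_over :: "'a set \<Rightarrow> 'a list set \<Rightarrow> bool" where
  "regular_over A L \<longleftrightarrow>
     (\<exists>(Q :: nat set) \<delta> q0 F. finite Q \<and> q0 \<in> Q \<and> F \<subseteq> Q \<and>
        (\<forall>q\<in>Q. \<forall>a\<in>A. \<delta> q a \<in> Q) \<and>
        L = {w \<in> lists A. foldl \<delta> q0 w \<in> F})"

datatype ('n, 't) gsymbol = NT 'n | Tm 't

inductive derives ::
  "('n \<times> ('n, 't) gsymbol list) set \<Rightarrow> ('n, 't) gsymbol list \<Rightarrow> ('n, 't) gsymbol list \<Rightarrow> bool"
  for P where
  "(X, \<gamma>) \<in> P \<Longrightarrow> derives P (u @ NT X # v) (u @ \<gamma> @ v)"

definition grammar_language ::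
  "('n \<times> ('n, 't) gsymbol list) set \<Rightarrow> 'n \<Rightarrow> 't list set" where
  "grammar_language P X = {w. (derives P)\<^sup>*\<^sup>* [NT X] (map Tm w)}"

text \<open>A finite grammar involves only finitely many nonterminals, so naturals suffice as their names.\<close>

definition context_free_over :: "'t set \<Rightarrow> 't list set \<Rightarrow> bool" where
  "context_free_over A L \<longleftrightarrow> L \<subseteq> lists A \<and>
     (\<exists>(P :: (nat \<times> (nat, 't) gsymbol list) set) X. finite P \<and> L = grammar_language P X)"

text \<open>The type extends an alphabet by the two new symbols, so freshness is automatic.\<close>

datatype 'a hsymbol = Letter 'a | Hash1 | Hash2

definition mult_word :: "'a list \<Rightarrow> 'a list \<Rightarrow> 'a list \<Rightarrow> 'a hsymbol list" where
  "mult_word u v w = map Letter u @ [Hash1] @ map Letter v @ [Hash2] @ map Letter (rev w)"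

record 'a wh_struct =
  alph :: "'a set"
  Lang :: "'a list set"
  Mult :: "'a hsymbol list set"

definition pre_word_hyperbolic :: "'a wh_struct \<Rightarrow> bool" where
  "pre_word_hyperbolic \<Sigma> \<longleftrightarrow>
     finite (alph \<Sigma>) \<and>
     regular_over (alph \<Sigma>) (Lang \<Sigma>) \<and> [] \<notin> Lang \<Sigma> \<and>
     context_free_over (Letter ` alph \<Sigma> \<union> {Hash1, Hash2}) (Mult \<Sigma>) \<and>
     Mult \<Sigma> \<subseteq> {mult_word u v w | u v w. u \<in> Lang \<Sigma> \<and> v \<in> Lang \<Sigma> \<and> w \<in> Lang \<Sigma>}"

definition nonempty_words :: "'a set \<Rightarrow> 'a list set" where
  "nonempty_words A = lists A - {[]}"

text \<open>The semigroup is the whole type \<open>'s\<close>. Only the values of \<open>\<phi>\<close> on non-empty words over the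
  alphabet matter.\<close>

definition interprets :: "'a wh_struct \<Rightarrow> ('a list \<Rightarrow> 's::semigroup_mult) \<Rightarrow> bool" where
  "interprets \<Sigma> \<phi> \<longleftrightarrow>
     (\<forall>u \<in> nonempty_words (alph \<Sigma>). \<forall>v \<in> nonempty_words (alph \<Sigma>). \<phi> (u @ v) = \<phi> u * \<phi> v) \<and>
     inj_on (\<lambda>a. \<phi> [a]) (alph \<Sigma>) \<and>
     \<phi> ` Lang \<Sigma> = UNIV \<and>
     Mult \<Sigma> = {mult_word u v w | u v w.
       u \<in> Lang \<Sigma> \<and> v \<in> Lang \<Sigma> \<and> w \<in> Lang \<Sigma> \<and> \<phi> u * \<phi> v = \<phi> w}"

text \<open>\<open>\<phi>\<close> witnesses that \<open>\<alpha>\<close> is an assignment of generators, i.e. \<open>\<phi>\<close> is consistent with \<open>\<alpha>\<close>.\<close>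

definition consistent_interpretation ::
  "'a wh_struct \<Rightarrow> ('a \<Rightarrow> 'a list) \<Rightarrow> ('a list \<Rightarrow> 's::semigroup_mult) \<Rightarrow> bool" where
  "consistent_interpretation \<Sigma> \<alpha> \<phi> \<longleftrightarrow>
     interprets \<Sigma> \<phi> \<and> (\<forall>a \<in> alph \<Sigma>. \<alpha> a \<in> Lang \<Sigma> \<and> \<phi> (\<alpha> a) = \<phi> [a])"

text \<open>Interpreted structures are normalised: letters belong to the language of representatives
  and the assignment of generators is the embedding of letters as one-letter words.\<close>

definition interpreted_word_hyperbolic ::
  "'a wh_struct \<Rightarrow> ('a list \<Rightarrow> 's::semigroup_mult) \<Rightarrow> bool" where
  "interpreted_word_hyperbolic \<Sigma> \<phi> \<longleftrightarrow>
     pre_word_hyperbolic \<Sigma> \<and> (\<lambda>a. [a]) ` alph \<Sigma> \<subseteq> Lang \<Sigma> \<and>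
     consistent_interpretation \<Sigma> (\<lambda>a. [a]) \<phi>"

definition right_units :: "'a wh_struct \<Rightarrow> 'a \<Rightarrow> 'a list set" where
  "right_units \<Sigma> a = {i \<in> Lang \<Sigma>. mult_word [a] i [a] \<in> Mult \<Sigma>}"

datatype 'a outcome = No | Yes "'a list"

definition identity_test ::
  "'a wh_struct \<Rightarrow> ('a list \<Rightarrow> 's::semigroup_mult) \<Rightarrow> 'a list \<Rightarrow> bool" where
  "identity_test \<Sigma> \<phi> i \<longleftrightarrow>
     (\<forall>b \<in> alph \<Sigma>. \<phi> i * \<phi> [b] = \<phi> [b] \<and> \<phi> [b] * \<phi> i = \<phi> [b])"

fun search ::
  "'a wh_struct \<Rightarrow> ('a list \<Rightarrow> 's::semigroup_mult) \<Rightarrow> ('a \<Rightarrow> 'a list) \<Rightarrow> 'a list \<Rightarrow> 'a outcome" where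
  "search \<Sigma> \<phi> c [] = No"
| "search \<Sigma> \<phi> c (a # as) =
     (if identity_test \<Sigma> \<phi> (c a) then Yes (c a) else search \<Sigma> \<phi> c as)"

text \<open>The algorithm is non-deterministic: \<open>run \<Sigma> \<phi> r\<close> says that \<open>r\<close> is the output of some run. The
  choice function \<open>c\<close> (\<open>c a\<close> is the chosen element of \<open>I\<^sub>a\<close>) and the order \<open>as\<close> in
  which the final loop visits the letters are arbitrary.\<close>

inductive run :: "'a wh_struct \<Rightarrow> ('a list \<Rightarrow> 's::semigroup_mult) \<Rightarrow> 'a outcome \<Rightarrow> bool"
  for \<Sigma> \<phi> where
  check_fails: "a \<in> alph \<Sigma> \<Longrightarrow> right_units \<Sigma> a = {} \<Longrightarrow> run \<Sigma> \<phi> No"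
| check_succeeds: "(\<And>a. a \<in> alph \<Sigma> \<Longrightarrow> c a \<in> right_units \<Sigma> a) \<Longrightarrow>
     set as = alph \<Sigma> \<Longrightarrow> distinct as \<Longrightarrow> run \<Sigma> \<phi> (search \<Sigma> \<phi> c as)"

end

theory Submission
  imports Defs "HOL-Library.Nat_Bijection"
begin

text \<open>Context-freeness of \<open>I\<^sub>a\<close>: it is the image of \<open>M\<close> under a finite transducer which consumes the
  prefix \<open>a #\<^sub>1\<close> and the suffix \<open>#\<^sub>2 a\<close> and copies what is in between. Context-free languages are
  closed under finite transductions by the triple construction, whose nonterminals \<open>(p, X, q)\<close>
  produce the outputs of the paths from \<open>p\<close> to \<open>q\<close> reading a word derived from \<open>X\<close>.

  Correctness: if the semigroup has an identity \<open>1\<close>, write \<open>1\<close> as a product \<open>u a\<close> with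
  \<open>a\<close> a generator. As \<open>a i\<^sub>a = a\<close>, we get \<open>i\<^sub>a = 1 i\<^sub>a = u a i\<^sub>a = u a = 1\<close>. So however the \<open>i\<^sub>a\<close>
  are chosen, one of them represents the identity.\<close>

section \<open>Finite transductions of context-free languages\<close>

text \<open>Each transition consumes exactly one input letter and emits a whole word. Having no
  moves without input is what bounds the number of lifts of a right-hand side in
  \<open>finite_lifts\<close>.\<close>

inductive transduces ::
  "(nat \<times> 't \<times> 'u list \<times> nat) set \<Rightarrow> nat \<Rightarrow> 't list \<Rightarrow> nat \<Rightarrow> 'u list \<Rightarrow> bool"
  for T where
  Nil: "transduces T p [] p []"
| Cons: "(p, t, v, q) \<in> T \<Longrightarrow> transduces T q ts r vs \<Longrightarrow> transduces T p (t # ts) r (v @ vs)"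

inductive_simps transduces_Nil [simp]: "transduces T p [] q v"
inductive_simps transduces_Cons: "transduces T p (t # ts) q v"

text \<open>\<open>context_free_over\<close> demands naturals as nonterminals, so the triples are
  coded by a pairing, of which only injectivity matters.\<close>

definition triple :: "nat \<Rightarrow> nat \<Rightarrow> nat \<Rightarrow> nat" where
  "triple p X q = prod_encode (p, prod_encode (X, q))"

lemma triple_eq_iff [simp]: "triple p X q = triple p' X' q' \<longleftrightarrow> p = p' \<and> X = X' \<and> q = q'"
  by (simp add: triple_def)

text \<open>A sentential form of the original grammar is lifted along a path of the transducer that guesses a
  pair of states around each nonterminal. Derivation steps commute with lifting in both directions,
  so no derivation trees are needed.\<close>

inductive lifts ::
  "nat set \<Rightarrow> (nat \<times> 't \<times> 'u list \<times> nat) set \<Rightarrow>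
     nat \<Rightarrow> (nat, 't) gsymbol list \<Rightarrow> nat \<Rightarrow> (nat, 'u) gsymbol list \<Rightarrow> bool"
  for Q T where
  Nil: "lifts Q T p [] p []"
| Tm: "(p, t, v, q) \<in> T \<Longrightarrow> lifts Q T q \<gamma> r \<gamma>' \<Longrightarrow> lifts Q T p (Tm t # \<gamma>) r (map Tm v @ \<gamma>')"
| NT: "q \<in> Q \<Longrightarrow> lifts Q T q \<gamma> r \<gamma>' \<Longrightarrow> lifts Q T p (NT X # \<gamma>) r (NT (triple p X q) # \<gamma>')"

inductive_simps lifts_Nil [simp]: "lifts Q T p [] q \<gamma>'"
inductive_simps lifts_Tm: "lifts Q T p (Tm t # \<gamma>) q \<gamma>'"
inductive_simps lifts_NT: "lifts Q T p (NT X # \<gamma>) q \<gamma>'"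

text \<open>Confining the source state to \<open>Q\<close> keeps the rule set finite; the target
  state then lies in \<open>Q\<close> by \<open>lifts_target\<close> when the transitions stay
  within \<open>Q\<close>.\<close>

definition triple_rules ::
  "nat set \<Rightarrow> (nat \<times> 't \<times> 'u list \<times> nat) set \<Rightarrow> (nat \<times> (nat, 't) gsymbol list) set \<Rightarrow>
     (nat \<times> (nat, 'u) gsymbol list) set" where
  "triple_rules Q T P =
     {(triple p X q, \<gamma>') | p X q \<gamma>' \<gamma>. p \<in> Q \<and> (X, \<gamma>) \<in> P \<and> lifts Q T p \<gamma> q \<gamma>'}"

lemma lifts_append:
  "lifts Q T p \<gamma>\<^sub>1 q \<gamma>\<^sub>1' \<Longrightarrow> lifts Q T q \<gamma>\<^sub>2 r \<gamma>\<^sub>2' \<Longrightarrow> lifts Q T p (\<gamma>\<^sub>1 @ \<gamma>\<^sub>2) r (\<gamma>\<^sub>1' @ \<gamma>\<^sub>2')"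
  by (induction rule: lifts.induct) (auto intro: lifts.intros)

lemma lifts_appendE:
  assumes "lifts Q T p (\<gamma>\<^sub>1 @ \<gamma>\<^sub>2) r \<gamma>'"
  obtains q \<gamma>\<^sub>1' \<gamma>\<^sub>2' where "\<gamma>' = \<gamma>\<^sub>1' @ \<gamma>\<^sub>2'" "lifts Q T p \<gamma>\<^sub>1 q \<gamma>\<^sub>1'" "lifts Q T q \<gamma>\<^sub>2 r \<gamma>\<^sub>2'"
proof -
  have "\<exists>q \<gamma>\<^sub>1' \<gamma>\<^sub>2'. \<gamma>' = \<gamma>\<^sub>1' @ \<gamma>\<^sub>2' \<and> lifts Q T p \<gamma>\<^sub>1 q \<gamma>\<^sub>1' \<and> lifts Q T q \<gamma>\<^sub>2 r \<gamma>\<^sub>2'"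
    using assms
  proof (induction \<gamma>\<^sub>1 arbitrary: p \<gamma>')
    case (Cons s \<gamma>\<^sub>1)
    show ?case
    proof (cases s)
      case (NT X)
      then obtain q \<delta> where *: "\<gamma>' = NT (triple p X q) # \<delta>" "q \<in> Q" "lifts Q T q (\<gamma>\<^sub>1 @ \<gamma>\<^sub>2) r \<delta>"
        using Cons.prems by (auto simp: lifts_NT)
      from Cons.IH[OF *(3)] obtain q' \<delta>\<^sub>1 \<delta>\<^sub>2
        where "\<delta> = \<delta>\<^sub>1 @ \<delta>\<^sub>2" "lifts Q T q \<gamma>\<^sub>1 q' \<delta>\<^sub>1" "lifts Q T q' \<gamma>\<^sub>2 r \<delta>\<^sub>2" by blast
      with * NT show ?thesis by (metis append_Cons lifts.NT)
    next
      case (Tm t)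
      then obtain v q \<delta> where *: "\<gamma>' = map Tm v @ \<delta>" "(p, t, v, q) \<in> T"
          "lifts Q T q (\<gamma>\<^sub>1 @ \<gamma>\<^sub>2) r \<delta>"
        using Cons.prems by (auto simp: lifts_Tm)
      from Cons.IH[OF *(3)] obtain q' \<delta>\<^sub>1 \<delta>\<^sub>2
        where "\<delta> = \<delta>\<^sub>1 @ \<delta>\<^sub>2" "lifts Q T q \<gamma>\<^sub>1 q' \<delta>\<^sub>1" "lifts Q T q' \<gamma>\<^sub>2 r \<delta>\<^sub>2" by blast
      with * Tm show ?thesis by (metis append_assoc lifts.Tm)
    qed
  qed auto
  with that show thesis by blast
qed

text \<open>Terminals lift to terminals only, so a nonterminal of the lifted form stems from a
  nonterminal of the original form, and the path splits at the two states of the triple.\<close>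

lemma lifts_split_at_NT:
  assumes "lifts Q T p \<gamma> r (u' @ NT Z # v')"
  obtains u X v q q' where "\<gamma> = u @ NT X # v" "Z = triple q X q'" "q' \<in> Q"
    "lifts Q T p u q u'" "lifts Q T q' v r v'"
proof -
  have "\<exists>u X v q q'. \<gamma> = u @ NT X # v \<and> Z = triple q X q' \<and> q' \<in> Q \<and>
      lifts Q T p u q u' \<and> lifts Q T q' v r v'"
    using assms
  proof (induction p \<gamma> r "u' @ NT Z # v'" arbitrary: u' rule: lifts.induct)
    case (Tm p t x q \<gamma> r \<gamma>')
    \<comment> \<open>The output \<open>x\<close> of the transition is all terminals, so the marked
      nonterminal lies beyond it.\<close>
    have "\<exists>u''. u' = map Tm x @ u'' \<and> \<gamma>' = u'' @ NT Z # v'"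
      using Tm.hyps(4)
    proof (induction x arbitrary: u')
      case (Cons b x)
      then show ?case by (cases u') auto
    qed auto
    then obtain u'' where u'': "u' = map Tm x @ u''" "\<gamma>' = u'' @ NT Z # v'" by blast
    from Tm.hyps(3)[OF u''(2)] obtain u X v q1 q' where
      "\<gamma> = u @ NT X # v" "Z = triple q1 X q'" "q' \<in> Q" "lifts Q T q u q1 u''" "lifts Q T q' v r v'"
      by blast
    with u'' Tm.hyps(1) show ?case by (metis append_Cons lifts.Tm)
  next
    case (NT q \<gamma> r \<gamma>' p X)
    show ?case
    proof (cases u')
      case Nil
      with NT show ?thesis
        by (metis append_Nil lifts.Nil list.inject gsymbol.inject(1))
    next
      case (Cons s u'')
      with NT.hyps(4) have s: "s = NT (triple p X q)" "\<gamma>' = u'' @ NT Z # v'" by auto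
      from NT.hyps(3)[OF s(2)] obtain u Y v q1 q' where
        "\<gamma> = u @ NT Y # v" "Z = triple q1 Y q'" "q' \<in> Q" "lifts Q T q u q1 u''" "lifts Q T q' v r v'"
        by blast
      with s Cons NT.hyps(1) show ?thesis by (metis append_Cons lifts.NT)
    qed
  qed auto
  with that show thesis by blast
qed

lemma lifts_target: "lifts Q T p \<gamma> q \<gamma>' \<Longrightarrow> T \<subseteq> Q \<times> UNIV \<times> UNIV \<times> Q \<Longrightarrow> p \<in> Q \<Longrightarrow> q \<in> Q"
  by (induction rule: lifts.induct) auto

text \<open>A triple rule is a lifted rule of \<open>P\<close>: undoing the lift at the rewritten
  triple and splicing the two ends back gives the step in \<open>P\<close>.\<close>

lemma lifts_derives:
  assumes "derives (triple_rules Q T P) \<gamma>\<^sub>1' \<gamma>\<^sub>2'" "lifts Q T p \<gamma>\<^sub>1 q \<gamma>\<^sub>1'"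
  shows "\<exists>\<gamma>\<^sub>2. derives P \<gamma>\<^sub>1 \<gamma>\<^sub>2 \<and> lifts Q T p \<gamma>\<^sub>2 q \<gamma>\<^sub>2'"
  using assms(1)
proof cases
  case (1 Z \<delta>' u' v')
  from assms(2) 1 obtain u X v r r' where
    *: "\<gamma>\<^sub>1 = u @ NT X # v" "Z = triple r X r'" "lifts Q T p u r u'" "lifts Q T r' v q v'"
    by (auto elim: lifts_split_at_NT)
  with 1 obtain \<delta> where "(X, \<delta>) \<in> P" "lifts Q T r \<delta> r' \<delta>'"
    by (auto simp: triple_rules_def)
  with * 1 show ?thesis by (blast intro: lifts_append derives.intros)
qed

text \<open>Lifting goes backwards, from the result to the source: the path over the rewritten form
  shows at which states \<open>r\<close> and \<open>r'\<close> it enters and leaves \<delta>, and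
  these make up the triple put around \<open>X\<close>. Forwards, a guessed triple need not be
  realised by any path over \<delta>.\<close>

lemma derives_lifts:
  assumes "derives P \<gamma>\<^sub>1 \<gamma>\<^sub>2" "lifts Q T p \<gamma>\<^sub>2 q \<gamma>\<^sub>2'" "T \<subseteq> Q \<times> UNIV \<times> UNIV \<times> Q" "p \<in> Q"
  shows "\<exists>\<gamma>\<^sub>1'. derives (triple_rules Q T P) \<gamma>\<^sub>1' \<gamma>\<^sub>2' \<and> lifts Q T p \<gamma>\<^sub>1 q \<gamma>\<^sub>1'"
  using assms(1)
proof cases
  case (1 X \<delta> u v)
  with assms(2) obtain r r' u' \<delta>' v' where
    *: "\<gamma>\<^sub>2' = u' @ \<delta>' @ v'" "lifts Q T p u r u'" "lifts Q T r \<delta> r' \<delta>'" "lifts Q T r' v q v'"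
    by (metis lifts_appendE)
  have Q: "r \<in> Q" "r' \<in> Q" using * assms(3,4) lifts_target by metis+
  have "(triple r X r', \<delta>') \<in> triple_rules Q T P"
    using 1 * Q by (auto simp: triple_rules_def)
  then have "derives (triple_rules Q T P) (u' @ NT (triple r X r') # v') \<gamma>\<^sub>2'"
    unfolding *(1) by (rule derives.intros)
  moreover have "lifts Q T p \<gamma>\<^sub>1 q (u' @ NT (triple r X r') # v')"
    unfolding 1 using * Q by (blast intro: lifts_append lifts.NT)
  ultimately show ?thesis by blast
qed

lemma lifts_derives_rtranclp:
  assumes "(derives (triple_rules Q T P))\<^sup>*\<^sup>* \<gamma>\<^sub>1' \<gamma>\<^sub>2'" "lifts Q T p \<gamma>\<^sub>1 q \<gamma>\<^sub>1'"
  shows "\<exists>\<gamma>\<^sub>2. (derives P)\<^sup>*\<^sup>* \<gamma>\<^sub>1 \<gamma>\<^sub>2 \<and> lifts Q T p \<gamma>\<^sub>2 q \<gamma>\<^sub>2'"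
  using assms
  by (induction rule: rtranclp_induct) (meson lifts_derives rtranclp.intros)+

lemma derives_rtranclp_lifts:
  assumes "(derives P)\<^sup>*\<^sup>* \<gamma>\<^sub>1 \<gamma>\<^sub>2" "lifts Q T p \<gamma>\<^sub>2 q \<gamma>\<^sub>2'" "T \<subseteq> Q \<times> UNIV \<times> UNIV \<times> Q" "p \<in> Q"
  shows "\<exists>\<gamma>\<^sub>1'. (derives (triple_rules Q T P))\<^sup>*\<^sup>* \<gamma>\<^sub>1' \<gamma>\<^sub>2' \<and> lifts Q T p \<gamma>\<^sub>1 q \<gamma>\<^sub>1'"
  using assms(1)
\<comment> \<open>Only the last form has a given lift, so the induction runs from the end of the
  derivation to its start.\<close>
proof (induction rule: converse_rtranclp_induct)
  case base
  then show ?case using assms(2) by blast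
next
  case (step \<gamma> \<delta>)
  then obtain \<delta>' where *: "(derives (triple_rules Q T P))\<^sup>*\<^sup>* \<delta>' \<gamma>\<^sub>2'" "lifts Q T p \<delta> q \<delta>'"
    by blast
  with derives_lifts[OF step.hyps(1) *(2) assms(3,4)] show ?case
    by (meson converse_rtranclp_into_rtranclp)
qed

text \<open>Without nonterminals there is nothing to guess, so lifting amounts to running the
  transducer.\<close>

lemma lifts_map_Tm:
  "lifts Q T p (map Tm w) q \<gamma>' \<longleftrightarrow> (\<exists>v. \<gamma>' = map Tm v \<and> transduces T p w q v)"
proof (induction w arbitrary: p \<gamma>')
  case (Cons t w)
  then show ?case
    by (auto simp: lifts_Tm transduces_Cons) (metis map_append)+
qed auto

text \<open>A nonterminal in \<gamma> would leave a triple in the lifted form.\<close>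

lemma lifts_to_map_Tm:
  assumes "lifts Q T p \<gamma> q (map Tm v)"
  obtains w where "\<gamma> = map Tm w" "transduces T p w q v"
proof -
  have "\<exists>w. \<gamma> = map Tm w"
    using assms
  proof (induction p \<gamma> q "map Tm v :: (nat, 'b) gsymbol list" arbitrary: v rule: lifts.induct)
    case (Tm p t x q \<gamma> r \<gamma>')
    then obtain v' where "\<gamma>' = map Tm v'" by (metis append_eq_map_conv)
    with Tm.hyps(3) obtain w where "\<gamma> = map Tm w" by blast
    then show ?case by (metis list.simps(9))
  qed auto
  then obtain w where w: "\<gamma> = map Tm w" by blast
  moreover have "transduces T p w q v"
    using assms unfolding w lifts_map_Tm
    by (auto dest!: map_injective simp: inj_def)
  ultimately show thesis by (rule that)
qed

lemma grammar_language_triple_rules: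
  assumes "T \<subseteq> Q \<times> UNIV \<times> UNIV \<times> Q" "p \<in> Q" "q \<in> Q"
  shows "grammar_language (triple_rules Q T P) (triple p X q) =
    {v. \<exists>w \<in> grammar_language P X. transduces T p w q v}"
proof (intro set_eqI iffI)
  fix v
  assume "v \<in> grammar_language (triple_rules Q T P) (triple p X q)"
  moreover have "lifts Q T p [NT X] q [NT (triple p X q)]"
    using assms by (auto intro: lifts.intros)
  ultimately obtain \<gamma> where "(derives P)\<^sup>*\<^sup>* [NT X] \<gamma>" "lifts Q T p \<gamma> q (map Tm v)"
    using lifts_derives_rtranclp unfolding grammar_language_def by blast
  then show "v \<in> {v. \<exists>w \<in> grammar_language P X. transduces T p w q v}"
    by (auto simp: grammar_language_def elim!: lifts_to_map_Tm)
next
  fix v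
  assume "v \<in> {v. \<exists>w \<in> grammar_language P X. transduces T p w q v}"
  then obtain w where w: "(derives P)\<^sup>*\<^sup>* [NT X] (map Tm w)" "transduces T p w q v"
    by (auto simp: grammar_language_def)
  then have "lifts Q T p (map Tm w) q (map Tm v)" by (auto simp: lifts_map_Tm)
  \<comment> \<open>A lift of the one-symbol form \<open>[NT X]\<close> from \<open>p\<close> to
    \<open>q\<close> can only be the start triple.\<close>
  from derives_rtranclp_lifts[OF w(1) this assms(1,2)]
  show "v \<in> grammar_language (triple_rules Q T P) (triple p X q)"
    by (auto simp: grammar_language_def lifts_NT)
qed

text \<open>Each symbol of \<gamma> leaves finitely many choices: a guessed state in
  \<open>Q\<close> or a transition in \<open>T\<close>.\<close>

lemma finite_lifts:
  assumes "finite Q" "finite T"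
  shows "finite {(q, \<gamma>'). lifts Q T p \<gamma> q \<gamma>'}"
proof (induction \<gamma> arbitrary: p)
  case Nil
  have "{(q, \<gamma>'). lifts Q T p [] q \<gamma>'} = {(p, [])}" by auto
  then show ?case by simp
next
  case (Cons s \<gamma>)
  show ?case
  proof (cases s)
    case (NT X)
    have "{(q, \<gamma>'). lifts Q T p (s # \<gamma>) q \<gamma>'} \<subseteq>
        (\<Union>r\<in>Q. (\<lambda>(q, \<gamma>'). (q, NT (triple p X r) # \<gamma>')) ` {(q, \<gamma>'). lifts Q T r \<gamma> q \<gamma>'})"
      by (auto simp: NT lifts_NT)
    then show ?thesis
      by (rule finite_subset) (intro finite_UN_I finite_imageI assms Cons.IH)
  next
    case (Tm t)
    have "{(q, \<gamma>'). lifts Q T p (s # \<gamma>) q \<gamma>'} \<subseteq>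
        (\<Union>(p, t, v, r)\<in>T. (\<lambda>(q, \<gamma>'). (q, map Tm v @ \<gamma>')) ` {(q, \<gamma>'). lifts Q T r \<gamma> q \<gamma>'})"
      by (fastforce simp: Tm lifts_Tm)
    then show ?thesis
      by (rule finite_subset) (auto intro!: assms Cons.IH)
  qed
qed

lemma finite_triple_rules:
  assumes "finite Q" "finite T" "finite P"
  shows "finite (triple_rules Q T P)"
proof -
  have "triple_rules Q T P \<subseteq> (\<Union>p\<in>Q. \<Union>(X, \<gamma>)\<in>P.
      (\<lambda>(q, \<gamma>'). (triple p X q, \<gamma>')) ` {(q, \<gamma>'). lifts Q T p \<gamma> q \<gamma>'})"
    by (fastforce simp: triple_rules_def)
  then show ?thesis
    by (rule finite_subset) (auto intro!: finite_UN_I finite_imageI assms finite_lifts)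
qed

lemma transduces_output:
  "transduces T p w q v \<Longrightarrow> T \<subseteq> UNIV \<times> UNIV \<times> lists B \<times> UNIV \<Longrightarrow> v \<in> lists B"
  by (induction rule: transduces.induct) auto

theorem context_free_over_transduction:
  assumes "context_free_over A L" "finite Q" "finite T" "T \<subseteq> Q \<times> UNIV \<times> lists B \<times> Q"
    "p \<in> Q" "q \<in> Q"
  shows "context_free_over B {v. \<exists>w \<in> L. transduces T p w q v}"
proof -
  obtain P :: "(nat \<times> (nat, 'a) gsymbol list) set" and X
    where P: "finite P" "L = grammar_language P X"
    using assms(1) by (auto simp: context_free_over_def)
  have "T \<subseteq> Q \<times> UNIV \<times> UNIV \<times> Q" using assms(4) by auto
  then have "{v. \<exists>w \<in> L. transduces T p w q v} =
      grammar_language (triple_rules Q T P) (triple p X q)"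
    using assms(5,6) P(2) by (simp add: grammar_language_triple_rules)
  moreover have "{v. \<exists>w \<in> L. transduces T p w q v} \<subseteq> lists B"
  proof (rule subsetI, elim CollectE bexE)
    fix v w
    assume "transduces T p w q v"
    moreover have "T \<subseteq> UNIV \<times> UNIV \<times> lists B \<times> UNIV" using assms(4) by auto
    ultimately show "v \<in> lists B" by (rule transduces_output)
  qed
  ultimately show ?thesis
    unfolding context_free_over_def using finite_triple_rules[OF assms(2,3) P(1)] by blast
qed

section \<open>The transducer that extracts \<open>I\<^sub>a\<close> from \<open>M\<close>\<close>

definition unit_transducer :: "'a set \<Rightarrow> 'a \<Rightarrow> (nat \<times> 'a hsymbol \<times> 'a list \<times> nat) set" where
  "unit_transducer A a =
     {(0, Letter a, [], 1), (1, Hash1, [], 2), (2, Hash2, [], 3), (3, Letter a, [], 4)} \<union>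
     (\<lambda>b. (2, Letter b, [b], 2)) ` A"

text \<open>States 0 to 4 count the markers \<open>a\<close>, \<open>Hash1\<close>,
  \<open>Hash2\<close>, \<open>a\<close> consumed so far; state 2 also copies the middle word. The
  accepted inputs are computed from the final state backwards.\<close>

lemma transduces_unit_transducer:
  "transduces (unit_transducer A a) 0 w 4 v \<longleftrightarrow> w = mult_word [a] v [a] \<and> v \<in> lists A"
proof -
  define T where "T = unit_transducer A a"
  have T: "(\<exists>x\<in>T. P x) \<longleftrightarrow> P (0, Letter a, [], 1) \<or> P (1, Hash1, [], 2) \<or> P (2, Hash2, [], 3) \<or>
      P (3, Letter a, [], 4) \<or> (\<exists>b\<in>A. P (2, Letter b, [b], 2))" for P
    unfolding T_def unit_transducer_def bex_Un by simp
  have step: "transduces T p (t # ts) 4 v \<longleftrightarrow>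
      (\<exists>x\<in>T. case x of (p', t', v', q) \<Rightarrow>
        p' = p \<and> t' = t \<and> (\<exists>vs. v = v' @ vs \<and> transduces T q ts 4 vs))" for p t ts v
    by (subst transduces_Cons) fastforce
  have 4: "transduces T 4 w 4 v \<longleftrightarrow> w = [] \<and> v = []" for w v
    by (cases w) (auto simp: step T)
  have 3: "transduces T 3 w 4 v \<longleftrightarrow> w = [Letter a] \<and> v = []" for w v
    by (cases w) (auto simp: step T 4)
  \<comment> \<open>This is the only state with a loop, hence the induction on the input.\<close>
  have 2: "transduces T 2 w 4 v \<longleftrightarrow> w = map Letter v @ [Hash2, Letter a] \<and> v \<in> lists A" for w v
  proof (induction w arbitrary: v)
    case (Cons t ts)
    show ?case by (cases v) (auto simp: step T 3 Cons.IH)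
  qed auto
  have 1: "transduces T 1 w 4 v \<longleftrightarrow> (\<exists>w'. w = Hash1 # w' \<and> transduces T 2 w' 4 v)" for w v
    by (cases w) (auto simp: step T)
  have 0: "transduces T 0 w 4 v \<longleftrightarrow> (\<exists>w'. w = Letter a # w' \<and> transduces T 1 w' 4 v)"
    by (cases w) (auto simp: step T)
  show ?thesis unfolding T_def[symmetric] 0 1 2 by (auto simp: mult_word_def)
qed

section \<open>Interpreted word-hyperbolic structures\<close>

text \<open>A hash symbol is no letter, so the first one marks where the leading block of letters
  ends.\<close>

lemma map_Letter_append_Hash_eq:
  assumes "map Letter u @ h # x = map Letter u' @ h # x'" "h = Hash1 \<or> h = Hash2"
  shows "u = u' \<and> x = x'"
  using assms(1)
proof (induction u arbitrary: u')
  case Nil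
  then show ?case using assms(2) by (cases u') auto
next
  case (Cons a u)
  then show ?case using assms(2) by (cases u') auto
qed

lemma mult_word_eq_iff [simp]: "mult_word u v w = mult_word u' v' w' \<longleftrightarrow> u = u' \<and> v = v' \<and> w = w'"
proof
  assume "mult_word u v w = mult_word u' v' w'"
  then have *: "map Letter u @ Hash1 # map Letter v @ Hash2 # map Letter (rev w) =
      map Letter u' @ Hash1 # map Letter v' @ Hash2 # map Letter (rev w')"
    by (simp add: mult_word_def)
  then have "u = u'" "map Letter v @ Hash2 # map Letter (rev w) = map Letter v' @ Hash2 # map Letter (rev w')"
    by (blast dest: map_Letter_append_Hash_eq)+
  moreover from map_Letter_append_Hash_eq[OF this(2)]
  have "v = v'" "map Letter (rev w) = map Letter (rev w')" by auto
  moreover have "inj (Letter :: 'a \<Rightarrow> _)" by (simp add: inj_def)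
  ultimately show "u = u' \<and> v = v' \<and> w = w'" by (auto dest: map_injective)
qed simp

lemma context_free_right_units:
  assumes "pre_word_hyperbolic \<Sigma>"
  shows "context_free_over (alph \<Sigma>) (right_units \<Sigma> a)"
proof -
  let ?T = "unit_transducer (alph \<Sigma>) a"
  \<comment> \<open>That the copied word lies in \<open>Lang \<Sigma>\<close> comes from the shape
    of the words in \<open>Mult \<Sigma>\<close>; no intersection with a regular language is
    formed.\<close>
  have "right_units \<Sigma> a = {v. \<exists>w \<in> Mult \<Sigma>. transduces ?T 0 w 4 v}"
    using assms
    by (fastforce simp: transduces_unit_transducer right_units_def pre_word_hyperbolic_def
        regular_over_def)
  moreover have "context_free_over (alph \<Sigma>) {v. \<exists>w \<in> Mult \<Sigma>. transduces ?T 0 w 4 v}"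
    using assms
    by (intro context_free_over_transduction[where Q = "{..4}"])
      (auto simp: pre_word_hyperbolic_def unit_transducer_def)
  ultimately show ?thesis by simp
qed

text \<open>The last item reads \<open>I\<^sub>a\<close> in the semigroup: since \<open>[a]\<close>
  is itself in \<open>Lang \<Sigma>\<close>, membership in \<open>Mult \<Sigma>\<close> becomes an
  equation.\<close>

lemma interpreted_word_hyperbolicD:
  assumes "interpreted_word_hyperbolic \<Sigma> \<phi>"
  shows "finite (alph \<Sigma>)" "Lang \<Sigma> \<subseteq> nonempty_words (alph \<Sigma>)" "\<phi> ` Lang \<Sigma> = UNIV"
    "\<And>u v. u \<in> nonempty_words (alph \<Sigma>) \<Longrightarrow> v \<in> nonempty_words (alph \<Sigma>) \<Longrightarrow> \<phi> (u @ v) = \<phi> u * \<phi> v"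
    "\<And>a. a \<in> alph \<Sigma> \<Longrightarrow> right_units \<Sigma> a = {i \<in> Lang \<Sigma>. \<phi> [a] * \<phi> i = \<phi> [a]}"
  using assms
  by (auto simp: interpreted_word_hyperbolic_def pre_word_hyperbolic_def regular_over_def
      nonempty_words_def consistent_interpretation_def interprets_def right_units_def)

text \<open>Letters suffice because every element is a product of letters: \<open>\<phi> i\<close>
  is absorbed on the left by the first letter and on the right by the last.\<close>

lemma identity_test_iff_monoid:
  fixes \<phi> :: "'a list \<Rightarrow> 's::semigroup_mult"
  assumes "interpreted_word_hyperbolic \<Sigma> \<phi>"
  shows "identity_test \<Sigma> \<phi> i \<longleftrightarrow> monoid ((*) :: 's \<Rightarrow> 's \<Rightarrow> 's) (\<phi> i)"
proof
  note D = interpreted_word_hyperbolicD[OF assms]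
  assume id: "identity_test \<Sigma> \<phi> i"
  have words: "\<phi> i * \<phi> w = \<phi> w \<and> \<phi> w * \<phi> i = \<phi> w" if "w \<noteq> []" "w \<in> lists (alph \<Sigma>)" for w
    using that
  proof (induction w rule: list_nonempty_induct)
    case (single a)
    with id show ?case by (auto simp: identity_test_def)
  next
    case (cons a w)
    have eq: "\<phi> (a # w) = \<phi> [a] * \<phi> w"
      using D(4)[of "[a]" w] cons by (auto simp: nonempty_words_def)
    have "\<phi> i * \<phi> [a] = \<phi> [a]" "\<phi> w * \<phi> i = \<phi> w"
      using id cons by (auto simp: identity_test_def)
    then show ?case unfolding eq by (metis mult.assoc)
  qed
  have "\<phi> i * s = s \<and> s * \<phi> i = s" for s
  proof -
    obtain w where "w \<in> Lang \<Sigma>" "s = \<phi> w" using D(3) by (metis UNIV_I imageE)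
    with words D(2) show ?thesis by (auto simp: nonempty_words_def)
  qed
  then show "monoid ((*) :: 's \<Rightarrow> 's \<Rightarrow> 's) (\<phi> i)"
    by unfold_locales (auto simp: mult.assoc)
next
  assume "monoid ((*) :: 's \<Rightarrow> 's \<Rightarrow> 's) (\<phi> i)"
  then show "identity_test \<Sigma> \<phi> i"
    by (simp add: identity_test_def monoid.left_neutral monoid.right_neutral)
qed

text \<open>The letter \<open>a\<close> ends a word representing \<open>e\<close>. It is fixed
  before \<open>i\<close>, so every choice of \<open>i\<^sub>a\<close> succeeds at this
  letter.\<close>

lemma right_unit_is_identity:
  fixes \<phi> :: "'a list \<Rightarrow> 's::semigroup_mult"
  assumes "interpreted_word_hyperbolic \<Sigma> \<phi>" "monoid ((*) :: 's \<Rightarrow> 's \<Rightarrow> 's) e"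
  obtains a where "a \<in> alph \<Sigma>" "\<And>i. i \<in> right_units \<Sigma> a \<Longrightarrow> \<phi> i = e"
proof -
  note D = interpreted_word_hyperbolicD[OF assms(1)]
  obtain w where w: "w \<in> nonempty_words (alph \<Sigma>)" "\<phi> w = e" using D(2,3) by (metis UNIV_I imageE subsetD)
  then obtain u a where ua: "w = u @ [a]" "u \<in> lists (alph \<Sigma>)" "a \<in> alph \<Sigma>"
    by (cases w rule: rev_cases) (auto simp: nonempty_words_def)
  have "\<phi> i = e" if "i \<in> right_units \<Sigma> a" for i
  proof -
    have a: "\<phi> [a] * \<phi> i = \<phi> [a]" using that D(5) ua(3) by auto
    have "\<phi> w * \<phi> i = \<phi> w"
    \<comment> \<open>The homomorphism law covers non-empty words only, so \<open>u = []\<close> is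
      treated apart; there \<open>w = [a]\<close>.\<close>
    proof (cases "u = []")
      case False
      then have "\<phi> w = \<phi> u * \<phi> [a]"
        using D(4)[of u "[a]"] ua by (auto simp: nonempty_words_def)
      with a show ?thesis by (simp add: mult.assoc)
    qed (use a ua in simp)
    with w(2) assms(2) show ?thesis by (simp add: monoid.left_neutral)
  qed
  with ua(3) that show thesis by blast
qed

text \<open>In a monoid every non-emptiness check thus succeeds, and one representative of the
  identity may be chosen for all letters.\<close>

lemma right_units_identity:
  fixes \<phi> :: "'a list \<Rightarrow> 's::semigroup_mult"
  assumes "interpreted_word_hyperbolic \<Sigma> \<phi>" "monoid ((*) :: 's \<Rightarrow> 's \<Rightarrow> 's) (\<phi> i)"
    "i \<in> Lang \<Sigma>" "a \<in> alph \<Sigma>"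
  shows "i \<in> right_units \<Sigma> a"
  using assms interpreted_word_hyperbolicD(5)[OF assms(1,4)]
  by (simp add: monoid.right_neutral)

section \<open>Possible outputs of the algorithm\<close>

lemma search_eq_Yes: "search \<Sigma> \<phi> c as = Yes i \<Longrightarrow> \<exists>a \<in> set as. i = c a \<and> identity_test \<Sigma> \<phi> i"
  by (induction as) (auto split: if_splits)

lemma search_eq_No_iff: "search \<Sigma> \<phi> c as = No \<longleftrightarrow> (\<forall>a \<in> set as. \<not> identity_test \<Sigma> \<phi> (c a))"
  by (induction as) auto

lemma run_Yes_iff:
  fixes \<phi> :: "'a list \<Rightarrow> 's::semigroup_mult"
  assumes "interpreted_word_hyperbolic \<Sigma> \<phi>"
  shows "run \<Sigma> \<phi> (Yes i) \<longleftrightarrow> i \<in> Lang \<Sigma> \<and> monoid ((*) :: 's \<Rightarrow> 's \<Rightarrow> 's) (\<phi> i)"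
proof
  assume "run \<Sigma> \<phi> (Yes i)"
  then show "i \<in> Lang \<Sigma> \<and> monoid ((*) :: 's \<Rightarrow> 's \<Rightarrow> 's) (\<phi> i)"
  proof cases
    case (check_succeeds c as)
    then obtain a where "a \<in> alph \<Sigma>" "i = c a" "identity_test \<Sigma> \<phi> i"
      by (metis search_eq_Yes)
    with check_succeeds(2) identity_test_iff_monoid[OF assms] show ?thesis
      by (auto simp: right_units_def)
  qed
next
  assume i: "i \<in> Lang \<Sigma> \<and> monoid ((*) :: 's \<Rightarrow> 's \<Rightarrow> 's) (\<phi> i)"
  obtain as where as: "set as = alph \<Sigma>" "distinct as"
    using finite_distinct_list[OF interpreted_word_hyperbolicD(1)[OF assms]] by blast
  \<comment> \<open>To get a run with the prescribed output \<open>i\<close>, choose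
    \<open>i\<close> for every letter.\<close>
  have "run \<Sigma> \<phi> (search \<Sigma> \<phi> (\<lambda>_. i) as)"
    using right_units_identity[OF assms] i as by (intro run.check_succeeds) auto
  \<comment> \<open>The alphabet has to be non-empty for the loop to test \<open>i\<close> at
    all.\<close>
  moreover obtain a where "a \<in> set as"
    using right_unit_is_identity[OF assms] i as(1) by metis
  then have "search \<Sigma> \<phi> (\<lambda>_. i) as = Yes i"
    using identity_test_iff_monoid[OF assms] i by (cases as) auto
  ultimately show "run \<Sigma> \<phi> (Yes i)" by simp
qed

text \<open>In a monoid neither way to \<open>No\<close> is open: a representative of the identity
  keeps each \<open>I\<^sub>a\<close> non-empty, and at the letter of
  \<open>right_unit_is_identity\<close> any choice passes the test. Otherwise no test can pass,
  since a passing one would exhibit an identity.\<close>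

lemma run_No_iff:
  fixes \<phi> :: "'a list \<Rightarrow> 's::semigroup_mult"
  assumes "interpreted_word_hyperbolic \<Sigma> \<phi>"
  shows "run \<Sigma> \<phi> No \<longleftrightarrow> \<not> (\<exists>e. monoid ((*) :: 's \<Rightarrow> 's \<Rightarrow> 's) e)"
proof
  assume "run \<Sigma> \<phi> No"
  show "\<not> (\<exists>e. monoid ((*) :: 's \<Rightarrow> 's \<Rightarrow> 's) e)"
  proof
    assume "\<exists>e. monoid ((*) :: 's \<Rightarrow> 's \<Rightarrow> 's) e"
    then obtain e where e: "monoid ((*) :: 's \<Rightarrow> 's \<Rightarrow> 's) e" ..
    from \<open>run \<Sigma> \<phi> No\<close> show False
    proof cases
      case (check_fails a)
      obtain i where "i \<in> Lang \<Sigma>" "\<phi> i = e"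
        using interpreted_word_hyperbolicD(3)[OF assms] by (metis UNIV_I imageE)
      with e check_fails right_units_identity[OF assms] show False by blast
    next
      case (check_succeeds c as)
      obtain a where "a \<in> alph \<Sigma>" "\<And>i. i \<in> right_units \<Sigma> a \<Longrightarrow> \<phi> i = e"
        using right_unit_is_identity[OF assms e] by blast
      with check_succeeds(2) e have "identity_test \<Sigma> \<phi> (c a)"
        by (simp add: identity_test_iff_monoid[OF assms])
      with check_succeeds \<open>a \<in> alph \<Sigma>\<close> show False by (metis search_eq_No_iff)
    qed
  qed
next
  assume no: "\<not> (\<exists>e. monoid ((*) :: 's \<Rightarrow> 's \<Rightarrow> 's) e)"
  show "run \<Sigma> \<phi> No"
  proof (cases "\<exists>a \<in> alph \<Sigma>. right_units \<Sigma> a = {}")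
    case True
    then show ?thesis by (auto intro: run.check_fails)
  next
    case False
    then have "\<forall>a \<in> alph \<Sigma>. \<exists>i. i \<in> right_units \<Sigma> a" by blast
    from bchoice[OF this] obtain c where c: "\<And>a. a \<in> alph \<Sigma> \<Longrightarrow> c a \<in> right_units \<Sigma> a"
      by blast
    obtain as where as: "set as = alph \<Sigma>" "distinct as"
      using finite_distinct_list[OF interpreted_word_hyperbolicD(1)[OF assms]] by blast
    have "search \<Sigma> \<phi> c as = No"
      using no identity_test_iff_monoid[OF assms] by (auto simp: search_eq_No_iff)
    with run.check_succeeds[OF c as, of \<phi>] show ?thesis by simp
  qed
qed

text \<open>As the runs are non-deterministic, the two equivalences work together: in a monoid
  \<open>No\<close> is impossible, so every run outputs \<open>Yes\<close>, and always with a
  representative of the identity.\<close>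

theorem proposition8p2:
  fixes \<Sigma> :: "'a wh_struct" and \<phi> :: "'a list \<Rightarrow> 's::semigroup_mult"
  assumes "interpreted_word_hyperbolic \<Sigma> \<phi>"
  shows "(\<forall>a \<in> alph \<Sigma>. context_free_over (alph \<Sigma>) (right_units \<Sigma> a)) \<and>
    (\<forall>i. run \<Sigma> \<phi> (Yes i) \<longleftrightarrow> i \<in> Lang \<Sigma> \<and> monoid ((*) :: 's \<Rightarrow> 's \<Rightarrow> 's) (\<phi> i)) \<and>
    (run \<Sigma> \<phi> No \<longleftrightarrow> \<not> (\<exists>e. monoid ((*) :: 's \<Rightarrow> 's \<Rightarrow> 's) e))"
proof (intro conjI ballI allI)
  show "context_free_over (alph \<Sigma>) (right_units \<Sigma> a)" for a
    using assms by (simp add: context_free_right_units interpreted_word_hyperbolic_def)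
qed (fact run_Yes_iff[OF assms] run_No_iff[OF assms])+

end
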